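(* Let $r\geq t\geq 3$. There is $N$ (depending on $r$ and $t$) such that if $n_1\geq\cdots\geq n_r$ and $n_{t-1}\geq N$, then every extremal graph for $K_t$ in $K_{n_1,\ldots,n_r}$ (i.e. every $K_t$-free spanning subgraph of $K_{n_1,\ldots,n_r}$ with ${\rm ex}(n_1,\ldots,n_r,K_t)$ edges) is $(t-1)$-partite.
   Context: $K_{n_1,\ldots,n_r}$ is the complete $r$-partite graph with parts $V_1,\ldots,V_r$ of sizes $n_1,\ldots,n_r$. ${\rm ex}(n_1,\ldots,n_r,K_t)$ is the maximum number of edges of a $K_t$-free spanning subgraph of $K_{n_1,\ldots,n_r}$. A graph is $(t-1)$-partite if its vertex set can be partitioned into $t-1$ independent sets. *)

theory Defs
  imports "HOL-Library.Ramsey" "HOL-Library.Disjoint_Sets"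
begin

text \<open>
  A simple graph is given by a vertex set and a set of two-element edges. \<^const>\<open>clique\<close> and
  \<^const>\<open>indep\<close> take the candidate vertex set as first and the edge set as second argument.

  The part sizes are \<open>n 1, \<dots>, n r\<close>; the values of \<open>n\<close> outside \<open>{1..r}\<close> are irrelevant. The
  part \<open>V\<^sub>i\<close> of the complete multipartite graph is realised as \<open>{i} \<times> {1..n i}\<close>.
\<close>

definition multipartite_verts :: "nat \<Rightarrow> (nat \<Rightarrow> nat) \<Rightarrow> (nat \<times> nat) set" where
  "multipartite_verts r n = (SIGMA i:{1..r}. {1..n i})"

definition multipartite_edges :: "nat \<Rightarrow> (nat \<Rightarrow> nat) \<Rightarrow> (nat \<times> nat) set set" where
  "multipartite_edges r n =
     {{u, v} | u v. u \<in> multipartite_verts r n \<and> v \<in> multipartite_verts r n \<and> fst u \<noteq> fst v}"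

definition complete_free :: "nat \<Rightarrow> 'a set \<Rightarrow> 'a set set \<Rightarrow> bool" where
  "complete_free t V E \<longleftrightarrow> \<not> (\<exists>S \<in> nsets V t. clique S E)"

text \<open>A spanning subgraph has all the vertices, so it is determined by its set of edges.\<close>

definition free_spanning_subgraphs :: "nat \<Rightarrow> (nat \<Rightarrow> nat) \<Rightarrow> nat \<Rightarrow> (nat \<times> nat) set set set" where
  "free_spanning_subgraphs r n t =
     {E. E \<subseteq> multipartite_edges r n \<and> complete_free t (multipartite_verts r n) E}"

definition multipartite_ex :: "nat \<Rightarrow> (nat \<Rightarrow> nat) \<Rightarrow> nat \<Rightarrow> nat" where
  "multipartite_ex r n t = Max (card ` free_spanning_subgraphs r n t)"

definition extremal :: "nat \<Rightarrow> (nat \<Rightarrow> nat) \<Rightarrow> nat \<Rightarrow> (nat \<times> nat) set set \<Rightarrow> bool" where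
  "extremal r n t E \<longleftrightarrow> E \<in> free_spanning_subgraphs r n t \<and> card E = multipartite_ex r n t"

text \<open>As usual for \<open>k\<close>-partite graphs, classes are allowed to be empty.\<close>

definition k_partite :: "nat \<Rightarrow> 'a set \<Rightarrow> 'a set set \<Rightarrow> bool" where
  "k_partite k V E \<longleftrightarrow>
     (\<exists>P :: nat \<Rightarrow> 'a set. disjoint_family_on P {1..k} \<and> (\<Union>i\<in>{1..k}. P i) = V \<and>
        (\<forall>i\<in>{1..k}. indep (P i) E))"

text \<open>The maximum in \<^const>\<open>multipartite_ex\<close> ranges over a finite nonempty set.\<close>

lemma finite_multipartite_edges: "finite (multipartite_edges r n)"
proof (rule finite_subset)
  show "multipartite_edges r n \<subseteq> Pow (multipartite_verts r n)"
    by (auto simp: multipartite_edges_def)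
  show "finite (Pow (multipartite_verts r n))"
    by (simp add: multipartite_verts_def)
qed

lemma finite_free_spanning_subgraphs: "finite (free_spanning_subgraphs r n t)"
  by (rule finite_subset[of _ "Pow (multipartite_edges r n)"])
    (auto simp: free_spanning_subgraphs_def finite_multipartite_edges)

lemma free_spanning_subgraphs_nonempty:
  assumes "t \<ge> 2"
  shows "free_spanning_subgraphs r n t \<noteq> {}"
proof -
  have "\<not> clique S {}" if "S \<in> nsets (multipartite_verts r n) t" for S
  proof
    assume "clique S {}"
    then have "\<forall>v\<in>S. \<forall>w\<in>S. v = w" by (auto simp: clique_def)
    moreover have "finite S" "card S = t" using that by (auto simp: nsets_def)
    ultimately have "card S \<le> 1" by (metis card_le_Suc0_iff_eq One_nat_def)
    with \<open>card S = t\<close> assms show False by simp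
  qed
  then have "{} \<in> free_spanning_subgraphs r n t"
    by (auto simp: free_spanning_subgraphs_def complete_free_def)
  then show ?thesis by blast
qed

end

theory Submission
  imports Defs Complex_Main
begin

text \<open>
  Choose one vertex from each nonempty part and weight the vertex from \<open>V\<^sub>i\<close> by \<open>n\<^sub>i\<close>. Averaged over all
  such transversals, the weighted number of edges induced by a \<open>K\<^sub>t\<close>-free graph \<open>G\<close> is \<open>e(G)\<close>, and
  blowing up a weighted \<open>K\<^sub>t\<close>-free graph gives a feasible graph. Hence every transversal of an extremal
  graph induces a \<open>K\<^sub>t\<close>-free graph of maximum weight. By Zykov symmetrisation nonadjacency is transitive
  in such a graph, and it contains a \<open>K\<^sub>t\<^sub>-\<^sub>1\<close> as soon as \<open>t - 1\<close> parts are nonempty, so \<open>N = 1\<close> suffices.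
  The structures of the different transversals are then glued together along \<open>t - 1\<close> rigid parts.
\<close>

section \<open>Maximum-weight graphs without a clique of size \<open>t\<close>: Zykov
  symmetrisation\<close>

definition no_clique :: "nat \<Rightarrow> 'a set \<Rightarrow> ('a \<Rightarrow> 'a \<Rightarrow> bool) \<Rightarrow> bool" where
  "no_clique k I A \<longleftrightarrow> (\<forall>S\<subseteq>I. card S = k \<longrightarrow> \<not> pairwise A S)"

text \<open>Ordered pairs are counted, so for symmetric irreflexive \<open>A\<close> each edge
  contributes \<open>2 * w i * w j\<close>.\<close>

definition weight :: "('a \<Rightarrow> real) \<Rightarrow> 'a set \<Rightarrow> ('a \<Rightarrow> 'a \<Rightarrow> bool) \<Rightarrow> real" where
  "weight w I A = (\<Sum>i\<in>I. w i * (\<Sum>j\<in>I. w j * of_bool (A i j)))"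

locale weighted_extremal =
  fixes t :: nat and I :: "'a set" and w :: "'a \<Rightarrow> real" and A :: "'a \<Rightarrow> 'a \<Rightarrow> bool"
  assumes fin: "finite I"
    and pos: "i \<in> I \<Longrightarrow> w i > 0"
    and sym: "symp A"
    and irrefl: "irreflp A"
    and free: "no_clique t I A"
    and maximal: "symp B \<Longrightarrow> irreflp B \<Longrightarrow> no_clique t I B \<Longrightarrow> weight w I B \<le> weight w I A"
begin

text \<open>Pulling back along \<open>f\<close> is the symmetrisation move: \<open>i\<close> becomes
  a clone of \<open>f i\<close>. Irreflexivity makes \<open>f\<close> injective on cliques of the
  pullback, so their images are cliques of the same size.\<close>

lemma weight_pullback_le:
  assumes "f ` I \<subseteq> I"
  shows "weight w I (\<lambda>i j. A (f i) (f j)) \<le> weight w I A"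
proof (rule maximal)
  show "symp (\<lambda>i j. A (f i) (f j))" using sym by (auto simp: symp_def)
  show "irreflp (\<lambda>i j. A (f i) (f j))" using irrefl by (auto simp: irreflp_def)
  show "no_clique t I (\<lambda>i j. A (f i) (f j))"
    unfolding no_clique_def
  proof (intro allI impI notI)
    fix S assume S: "S \<subseteq> I" "card S = t" "pairwise (\<lambda>i j. A (f i) (f j)) S"
    have "inj_on f S"
      using S(3) irrefl by (force simp: inj_on_def pairwise_def irreflp_def)
    then have "card (f ` S) = t" by (simp add: card_image S)
    moreover have "pairwise A (f ` S)" using S(3) by (auto simp: pairwise_def)
    moreover have "f ` S \<subseteq> I" using S assms by auto
    ultimately show False using free by (auto simp: no_clique_def)
  qed
qed

definition degree :: "'a \<Rightarrow> real" where
  "degree i = (\<Sum>j\<in>I. w j * of_bool (A i j))"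

text \<open>Stated for an update of an arbitrary \<open>f\<close>, so that it can be applied twice
  when two vertices are replaced.\<close>

lemma sum_fun_upd:
  fixes g :: "'a \<Rightarrow> real"
  assumes "y \<in> I"
  shows "(\<Sum>i\<in>I. w i * g ((f(y := x)) i)) = (\<Sum>i\<in>I. w i * g (f i)) + w y * (g x - g (f y))"
proof -
  have "(\<Sum>i\<in>I. w i * g ((f(y := x)) i)) =
    (\<Sum>i\<in>I. w i * g (f i) + (if i = y then w y * (g x - g (f y)) else 0))"
    by (intro sum.cong refl) (auto simp: algebra_simps)
  also have "\<dots> = (\<Sum>i\<in>I. w i * g (f i)) + w y * (g x - g (f y))"
    using fin assms by (simp add: sum.distrib)
  finally show ?thesis .
qed

lemma A_sym: "A i j \<longleftrightarrow> A j i"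
  using sym by (auto simp: symp_def)

lemma A_irrefl [simp]: "\<not> A i i"
  using irrefl by (auto simp: irreflp_def)

text \<open>Replacing \<open>y\<close> by a clone of \<open>x\<close> changes the weight by exactly
  \<open>2 * w y * (degree x - degree y)\<close>, which maximality makes nonpositive. Swapping the
  roles gives equal degrees.\<close>

lemma degree_le:
  assumes "x \<in> I" "y \<in> I" "\<not> A x y"
  shows "degree x \<le> degree y"
proof -
  define f where "f = id(y := x)"
  \<comment> \<open>\<open>g i\<close> is the degree of \<open>i\<close> once the weight of
    \<open>y\<close> is moved to \<open>x\<close>.\<close>
  define g where "g i = degree i + w y * (of_bool (A i x) - of_bool (A i y))" for i
  have yx: "\<not> A y x" using assms A_sym by blast
  have inner: "(\<Sum>j\<in>I. w j * of_bool (A (f i) (f j))) = g (f i)" for i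
    unfolding f_def sum_fun_upd[OF assms(2), of "\<lambda>j. of_bool (A ((id(y := x)) i) j)"]
    by (simp add: g_def degree_def)
  have "weight w I (\<lambda>i j. A (f i) (f j)) = (\<Sum>i\<in>I. w i * g (f i))"
    by (simp add: weight_def inner)
  also have "\<dots> = (\<Sum>i\<in>I. w i * g i) + w y * (g x - g y)"
    unfolding f_def using sum_fun_upd[OF assms(2), of g id x] by simp
  also have "g x - g y = degree x - degree y"
    using assms yx by (simp add: g_def)
  also have "(\<Sum>i\<in>I. w i * g i) = weight w I A + w y * (\<Sum>i\<in>I. w i * (of_bool (A i x) - of_bool (A i y)))"
    by (simp add: g_def weight_def degree_def algebra_simps sum.distrib sum_distrib_left sum_subtractf)
  also have "(\<Sum>i\<in>I. w i * (of_bool (A i x) - of_bool (A i y))) = degree x - degree y"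
    by (simp add: degree_def A_sym[of _ x] A_sym[of _ y] algebra_simps sum_subtractf)
  finally have "weight w I (\<lambda>i j. A (f i) (f j)) = weight w I A + 2 * w y * (degree x - degree y)"
    by simp
  moreover have "weight w I (\<lambda>i j. A (f i) (f j)) \<le> weight w I A"
    by (rule weight_pullback_le) (use assms in \<open>auto simp: f_def\<close>)
  ultimately have "w y * (degree x - degree y) \<le> 0" by simp
  then show ?thesis using pos[OF assms(2)] by (simp add: mult_le_0_iff)
qed

text \<open>Suppose \<open>x\<close> and \<open>z\<close> are adjacent but both nonadjacent to
  \<open>y\<close>. All three degrees agree, so turning both into clones of \<open>y\<close> has no
  first-order effect. The edge between \<open>x\<close> and \<open>z\<close> is counted in both
  degrees but lost only once, which leaves a gain of \<open>2 * w x * w z\<close>.\<close>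

lemma nonadjacent_trans:
  assumes I: "x \<in> I" "y \<in> I" "z \<in> I" and xy: "\<not> A x y" and yz: "\<not> A y z"
  shows "\<not> A x z"
proof
  assume xz: "A x z"
  have ne: "x \<noteq> z" "x \<noteq> y" "z \<noteq> y" using xy yz xz by auto
  have nadj: "\<not> A y x" "\<not> A z y" "A z x" using xy yz xz A_sym by blast+
  have deg: "degree x = degree y" "degree z = degree y"
    using degree_le I xy yz nadj by (meson antisym)+
  define f where "f = id(x := y, z := y)"
  define g where "g i = degree i + w x * (of_bool (A i y) - of_bool (A i x))
     + w z * (of_bool (A i y) - of_bool (A i z))" for i
  have upd: "(\<Sum>i\<in>I. w i * h (f i)) = (\<Sum>i\<in>I. w i * h i) + w x * (h y - h x) + w z * (h y - h z)"
    for h :: "'a \<Rightarrow> real"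
    unfolding f_def sum_fun_upd[OF I(3)] sum_fun_upd[OF I(1)] using ne by simp
  have inner: "(\<Sum>j\<in>I. w j * of_bool (A (f i) (f j))) = g (f i)" for i
    using upd[of "\<lambda>j. of_bool (A (f i) j)"] by (simp add: g_def degree_def)
  have "weight w I (\<lambda>i j. A (f i) (f j)) = (\<Sum>i\<in>I. w i * g (f i))"
    by (simp add: weight_def inner)
  also have "\<dots> = (\<Sum>i\<in>I. w i * g i) + w x * (g y - g x) + w z * (g y - g z)"
    by (rule upd)
  also have "g y - g x = w z"
    using xy yz xz nadj deg by (simp add: g_def)
  also have "g y - g z = w x"
    using xy yz xz nadj deg by (simp add: g_def)
  also have "(\<Sum>i\<in>I. w i * g i) = weight w I A
      + w x * (\<Sum>i\<in>I. w i * (of_bool (A i y) - of_bool (A i x)))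
      + w z * (\<Sum>i\<in>I. w i * (of_bool (A i y) - of_bool (A i z)))"
    by (simp add: g_def weight_def degree_def algebra_simps sum.distrib sum_distrib_left sum_subtractf)
  also have "(\<Sum>i\<in>I. w i * (of_bool (A i y) - of_bool (A i x))) = degree y - degree x"
    by (simp add: degree_def A_sym[of _ x] A_sym[of _ y] algebra_simps sum_subtractf)
  also have "(\<Sum>i\<in>I. w i * (of_bool (A i y) - of_bool (A i z))) = degree y - degree z"
    by (simp add: degree_def A_sym[of _ z] A_sym[of _ y] algebra_simps sum_subtractf)
  finally have "weight w I (\<lambda>i j. A (f i) (f j)) = weight w I A + 2 * (w x * w z)"
    using deg by simp
  moreover have "weight w I (\<lambda>i j. A (f i) (f j)) \<le> weight w I A"
    by (rule weight_pullback_le) (use I in \<open>auto simp: f_def\<close>)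
  moreover have "w x * w z > 0" using pos I by simp
  ultimately show False by simp
qed

text \<open>If there were no such clique, joining two nonadjacent vertices would create no clique of
  size \<open>t\<close> and increase the weight.\<close>

lemma ex_clique:
  assumes "t \<ge> 1" "t - 1 \<le> card I"
  obtains S where "S \<subseteq> I" "card S = t - 1" "pairwise A S"
proof (cases "pairwise A I")
  case True
  obtain S where "S \<subseteq> I" "card S = t - 1"
    using assms(2) obtain_subset_with_card_n by metis
  then show ?thesis using True that pairwise_subset by blast
next
  case False
  then obtain x y where xy: "x \<in> I" "y \<in> I" "x \<noteq> y" "\<not> A x y" by (auto simp: pairwise_def)
  have yx: "\<not> A y x" using xy A_sym by blast
  define B where "B i j \<longleftrightarrow> A i j \<or> (i = x \<and> j = y) \<or> (i = y \<and> j = x)" for i j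
  have "weight w I A < weight w I B"
    unfolding weight_def
  proof (rule sum_strict_mono_ex1[OF fin])
    have le: "w j * of_bool (A i j) \<le> w j * of_bool (B i j)" if "j \<in> I" for i j
      using pos[OF that] by (cases "A i j") (simp_all add: B_def)
    show "\<forall>i\<in>I. w i * (\<Sum>j\<in>I. w j * of_bool (A i j)) \<le> w i * (\<Sum>j\<in>I. w j * of_bool (B i j))"
      by (intro ballI mult_left_mono[OF sum_mono[OF le]] less_imp_le[OF pos])
    have "(\<Sum>j\<in>I. w j * of_bool (A x j)) < (\<Sum>j\<in>I. w j * of_bool (B x j))"
    proof (rule sum_strict_mono_ex1[OF fin])
      show "\<forall>j\<in>I. w j * of_bool (A x j) \<le> w j * of_bool (B x j)" using le by blast
      show "\<exists>j\<in>I. w j * of_bool (A x j) < w j * of_bool (B x j)"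
        using xy pos[OF xy(2)] by (intro bexI[of _ y]) (simp_all add: B_def)
    qed
    then show "\<exists>i\<in>I. w i * (\<Sum>j\<in>I. w j * of_bool (A i j)) < w i * (\<Sum>j\<in>I. w j * of_bool (B i j))"
      using xy(1) pos[OF xy(1)] by (intro bexI[of _ x] mult_strict_left_mono)
  qed
  moreover have "symp B" using sym by (auto simp: symp_def B_def)
  moreover have "irreflp B" using irrefl xy by (auto simp: irreflp_def B_def)
  ultimately have "\<not> no_clique t I B" using maximal by fastforce
  then obtain S where S: "S \<subseteq> I" "card S = t" "pairwise B S" by (auto simp: no_clique_def)
  have fS: "finite S" using S fin finite_subset by blast
  have "\<not> pairwise A S" using free S by (auto simp: no_clique_def)
  \<comment> \<open>\<open>B\<close> differs from \<open>A\<close> only in the pair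
    \<open>x\<close>, \<open>y\<close>, so a new clique contains \<open>x\<close>, and deleting
    \<open>x\<close> leaves a clique of \<open>A\<close>.\<close>
  then have "x \<in> S" using S(3) by (auto simp: pairwise_def B_def)
  moreover have "pairwise A (S - {x})" using S(3) by (auto simp: pairwise_def B_def)
  ultimately show ?thesis using that[of "S - {x}"] S fS by auto
qed

end

section \<open>Averaging over a product and counting ordered edges\<close>

text \<open>A uniformly random \<open>v\<close> takes prescribed values at two coordinates with
  probability \<open>1 / (card (F i) * card (F j))\<close>; the product form avoids
  division.\<close>

lemma card_PiE_fixed_pair:
  assumes "finite I" "\<And>i. i \<in> I \<Longrightarrow> finite (F i)" "i \<in> I" "j \<in> I" "i \<noteq> j" "a \<in> F i" "b \<in> F j"
  shows "card (F i) * card (F j) * card {v \<in> PiE I F. v i = a \<and> v j = b} = card (PiE I F)"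
proof -
  have "{v \<in> PiE I F. v i = a \<and> v j = b} = PiE I (F(i := {a}, j := {b}))"
    using assms(3-) by (fastforce simp: PiE_iff extensional_def split: if_splits)
  then have "card {v \<in> PiE I F. v i = a \<and> v j = b} = (\<Prod>k\<in>I. card ((F(i := {a}, j := {b})) k))"
    using assms(1) by (simp add: card_PiE)
  also have "\<dots> = (\<Prod>k\<in>I - {i} - {j}. card ((F(i := {a}, j := {b})) k))"
    using assms(1,3-5) by (simp add: prod.remove[of I i] prod.remove[of "I - {i}" j])
  also have "\<dots> = (\<Prod>k\<in>I - {i} - {j}. card (F k))"
    by (rule prod.cong) auto
  finally show ?thesis
    using assms(1,3-5) by (simp add: card_PiE prod.remove[of I i] prod.remove[of "I - {i}" j])
qed

text \<open>For parts of sizes \<open>n i\<close> and \<open>n j\<close> the prefactor is the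
  product of their weights. This is why weighting by size turns an expected weight into an edge
  count.\<close>

lemma sum_PiE_pair:
  fixes g :: "'b \<Rightarrow> 'b \<Rightarrow> real"
  assumes "finite I" "\<And>i. i \<in> I \<Longrightarrow> finite (F i)" "i \<in> I" "j \<in> I" "i \<noteq> j"
  shows "real (card (F i)) * real (card (F j)) * (\<Sum>v\<in>PiE I F. g (v i) (v j)) =
    real (card (PiE I F)) * (\<Sum>a\<in>F i. \<Sum>b\<in>F j. g a b)"
proof -
  let ?c = "real (card (F i)) * real (card (F j))"
  have fin: "finite (PiE I F)" using assms by (simp add: finite_PiE)
  have "(\<Sum>v\<in>PiE I F. g (v i) (v j)) =
    (\<Sum>p\<in>F i \<times> F j. \<Sum>v\<in>{v \<in> PiE I F. (v i, v j) = p}. g (v i) (v j))"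
    by (rule sum.group[symmetric]) (use assms fin in auto)
  also have "\<dots> = (\<Sum>p\<in>F i \<times> F j. g (fst p) (snd p) * card {v \<in> PiE I F. v i = fst p \<and> v j = snd p})"
    by (intro sum.cong refl) auto
  finally have "?c * (\<Sum>v\<in>PiE I F. g (v i) (v j)) =
    (\<Sum>p\<in>F i \<times> F j. g (fst p) (snd p) *
      real (card (F i) * card (F j) * card {v \<in> PiE I F. v i = fst p \<and> v j = snd p}))"
    by (simp add: sum_distrib_left mult_ac)
  also have "\<dots> = (\<Sum>p\<in>F i \<times> F j. g (fst p) (snd p) * real (card (PiE I F)))"
    by (intro sum.cong refl) (use assms in \<open>auto simp: card_PiE_fixed_pair simp del: of_nat_mult\<close>)
  also have "\<dots> = real (card (PiE I F)) * (\<Sum>a\<in>F i. \<Sum>b\<in>F j. g a b)"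
    by (simp add: sum.cartesian_product sum_distrib_left mult_ac case_prod_beta)
  finally show ?thesis .
qed

lemma card_ordered_edges:
  assumes "finite E" "\<And>e. e \<in> E \<Longrightarrow> card e = 2"
  shows "card {(u, v). {u, v} \<in> E} = 2 * card E"
proof -
  have fib: "card {(u, v). {u, v} = e} = 2" if e: "e \<in> E" for e
  proof -
    obtain a b where "e = {a, b}" "a \<noteq> b" using assms(2)[OF e] by (auto simp: card_2_iff)
    then have "{(u, v). {u, v} = e} = {(a, b), (b, a)}" by (auto simp: doubleton_eq_iff)
    then show ?thesis using \<open>a \<noteq> b\<close> by simp
  qed
  have "{(u, v). {u, v} \<in> E} = (\<Union>e\<in>E. {(u, v). {u, v} = e})" by auto
  also have "card \<dots> = (\<Sum>e\<in>E. card {(u, v). {u, v} = e})"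
  proof (rule card_UN_disjoint[OF assms(1)])
    show "\<forall>e\<in>E. finite {(u, v). {u, v} = e}" using fib by (metis card.infinite zero_neq_numeral)
  qed auto
  finally show ?thesis using fib by simp
qed

section \<open>Transversals of the multipartite graph and blow-ups\<close>

text \<open>Discarding empty parts makes all weights positive and lets a transversal meet every
  remaining part.\<close>

definition nonempty_parts :: "nat \<Rightarrow> (nat \<Rightarrow> nat) \<Rightarrow> nat set" where
  "nonempty_parts r n = {i \<in> {1..r}. n i > 0}"

text \<open>\<open>Pi\<close> leaves values at other indices free, so the constant function 1
  qualifies; the averaging uses \<open>PiE\<close> and transfers by restriction.\<close>

definition transversals :: "nat \<Rightarrow> (nat \<Rightarrow> nat) \<Rightarrow> (nat \<Rightarrow> nat) set" where
  "transversals r n = Pi (nonempty_parts r n) (\<lambda>i. {1..n i})"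

definition induced :: "(nat \<times> nat) set set \<Rightarrow> (nat \<Rightarrow> nat) \<Rightarrow> nat \<Rightarrow> nat \<Rightarrow> bool" where
  "induced E v i j \<longleftrightarrow> {(i, v i), (j, v j)} \<in> E"

lemma finite_nonempty_parts [simp]: "finite (nonempty_parts r n)"
  by (simp add: nonempty_parts_def)

lemma multipartite_verts_eq:
  "multipartite_verts r n = (SIGMA i:nonempty_parts r n. {1..n i})"
  by (auto simp: multipartite_verts_def nonempty_parts_def)

lemma card_multipartite_edge: "e \<in> multipartite_edges r n \<Longrightarrow> card e = 2"
  by (auto simp: multipartite_edges_def card_2_iff)

lemma induced_sym: "induced E v i j \<longleftrightarrow> induced E v j i"
  by (simp add: induced_def insert_commute)

lemma multipartite_edge_fst_neq:
  "{u, v} \<in> multipartite_edges r n \<Longrightarrow> fst u \<noteq> fst v"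
  by (auto simp: multipartite_edges_def doubleton_eq_iff)

lemma irreflp_induced:
  assumes "E \<subseteq> multipartite_edges r n"
  shows "irreflp (induced E v)"
proof (rule irreflpI)
  show "\<not> induced E v i i" for i
    using assms multipartite_edge_fst_neq[of "(i, v i)" "(i, v i)" r n]
    by (auto simp: induced_def)
qed

lemma no_clique_induced:
  assumes "complete_free t (multipartite_verts r n) E" "v \<in> transversals r n" "t > 0"
  shows "no_clique t (nonempty_parts r n) (induced E v)"
  unfolding no_clique_def
proof (intro allI impI notI)
  fix S assume S: "S \<subseteq> nonempty_parts r n" "card S = t" "pairwise (induced E v) S"
  let ?T = "(\<lambda>i. (i, v i)) ` S"
  have "finite S" using S(2) assms(3) card_gt_0_iff by blast
  then have "?T \<in> nsets (multipartite_verts r n) t"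
    using S assms(2)
    by (auto simp: nsets_def multipartite_verts_eq transversals_def card_image inj_on_def Pi_iff)
  moreover have "clique ?T E"
    using S(3) by (auto simp: clique_def pairwise_def induced_def)
  ultimately show False using assms(1) by (auto simp: complete_free_def)
qed

lemma sum_multipartite_verts:
  fixes g :: "nat \<times> nat \<Rightarrow> real"
  shows "(\<Sum>u\<in>multipartite_verts r n. g u) = (\<Sum>i\<in>nonempty_parts r n. \<Sum>a\<in>{1..n i}. g (i, a))"
  by (simp add: multipartite_verts_eq sum.Sigma)

lemma card_pairs_eq_sum:
  assumes "finite V"
  shows "real (card {(u, v). u \<in> V \<and> v \<in> V \<and> P u v}) = (\<Sum>u\<in>V. \<Sum>v\<in>V. of_bool (P u v))"
proof -
  have "{(u, v). u \<in> V \<and> v \<in> V \<and> P u v} = (SIGMA u:V. {v \<in> V. P u v})" by auto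
  then show ?thesis using assms
    by (simp add: sum.inter_filter[symmetric] of_bool_def)
qed

lemma finite_multipartite_verts [simp]: "finite (multipartite_verts r n)"
  by (simp add: multipartite_verts_def)

text \<open>The blow-up \<open>EB\<close> replaces each index by its whole part. A clique in it
  meets each part at most once, so \<open>fst\<close> maps it to a clique of \<open>B\<close> of the
  same size. Hence \<open>EB\<close> competes with \<open>E\<close>, and its ordered edges are
  counted by the weight of \<open>B\<close>.\<close>

lemma weight_le_extremal:
  assumes ext: "extremal r n t E" and "symp B" "irreflp B"
    and free: "no_clique t (nonempty_parts r n) B"
  shows "weight (\<lambda>i. real (n i)) (nonempty_parts r n) B \<le> 2 * card E"
proof -
  let ?V = "multipartite_verts r n" and ?I = "nonempty_parts r n"
  define EB where "EB = {{u, v} | u v. u \<in> ?V \<and> v \<in> ?V \<and> B (fst u) (fst v)}"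
  have sub: "EB \<subseteq> multipartite_edges r n"
    using \<open>irreflp B\<close> by (fastforce simp: EB_def multipartite_edges_def irreflp_def)
  have EB_iff: "{u, v} \<in> EB \<longleftrightarrow> u \<in> ?V \<and> v \<in> ?V \<and> B (fst u) (fst v)" for u v
    using \<open>symp B\<close> unfolding EB_def symp_def mem_Collect_eq doubleton_eq_iff by metis
  have "complete_free t ?V EB"
    unfolding complete_free_def
  proof (intro notI, elim bexE)
    fix S assume S: "S \<in> nsets ?V t" "clique S EB"
    then have adj: "B (fst u) (fst v)" if "u \<in> S" "v \<in> S" "u \<noteq> v" for u v
      using that EB_iff by (auto simp: clique_def)
    have "inj_on fst S"
      using adj \<open>irreflp B\<close> unfolding inj_on_def irreflp_def by metis
    then have "card (fst ` S) = t" using S by (simp add: card_image nsets_def)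
    moreover have "pairwise B (fst ` S)" using adj by (auto simp: pairwise_def)
    moreover have "fst ` S \<subseteq> ?I" using S by (auto simp: nsets_def multipartite_verts_eq)
    ultimately show False using free by (auto simp: no_clique_def)
  qed
  then have "EB \<in> free_spanning_subgraphs r n t"
    using sub by (simp add: free_spanning_subgraphs_def)
  then have "card EB \<le> card E"
    using ext by (simp add: extremal_def multipartite_ex_def finite_free_spanning_subgraphs)
  have "2 * card EB = card {(u, v). {u, v} \<in> EB}"
    using sub finite_multipartite_edges card_multipartite_edge
    by (intro card_ordered_edges[symmetric]) (auto intro: finite_subset)
  then have "real (2 * card EB) = real (card {(u, v). u \<in> ?V \<and> v \<in> ?V \<and> B (fst u) (fst v)})"
    by (simp only: EB_iff)
  also have "\<dots> = weight (\<lambda>i. real (n i)) ?I B"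
    by (simp add: card_pairs_eq_sum weight_def sum_multipartite_verts)
  finally show ?thesis using \<open>card EB \<le> card E\<close> by simp
qed

text \<open>Over a uniformly random transversal the expected weight of the induced graph is \<open>2 |E|\<close>,
  while no transversal can exceed this value.\<close>

lemma weight_induced_extremal:
  assumes ext: "extremal r n t E" and "t > 0" and v: "v \<in> transversals r n"
  shows "weight (\<lambda>i. real (n i)) (nonempty_parts r n) (induced E v) = 2 * card E"
proof -
  let ?V = "multipartite_verts r n" and ?I = "nonempty_parts r n"
  let ?F = "\<lambda>i. {1..n i}" and ?W = "\<lambda>v. weight (\<lambda>i. real (n i)) (nonempty_parts r n) (induced E v)"
  let ?h = "\<lambda>i a j b. of_bool ({(i, a), (j, b)} \<in> E) :: real"
  have E: "E \<subseteq> multipartite_edges r n" "complete_free t ?V E"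
    using ext by (auto simp: extremal_def free_spanning_subgraphs_def)
  have EV: "u \<in> ?V \<and> w \<in> ?V" if "{u, w} \<in> E" for u w
    using that E(1) by (auto simp: multipartite_edges_def doubleton_eq_iff)
  have le: "?W v \<le> 2 * card E" if "v \<in> PiE ?I ?F" for v
  proof (rule weight_le_extremal[OF ext])
    show "symp (induced E v)" by (auto simp: symp_def induced_sym)
    show "irreflp (induced E v)" using E(1) by (rule irreflp_induced)
    show "no_clique t ?I (induced E v)"
      using that \<open>t > 0\<close> E by (intro no_clique_induced) (auto simp: transversals_def)
  qed
  \<comment> \<open>Diagonal terms vanish because no edge lies inside a part; elsewhere the weights
    cancel the probability of hitting a given pair.\<close>
  have pair: "(\<Sum>v\<in>PiE ?I ?F. real (n i) * (real (n j) * ?h i (v i) j (v j))) =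
      real (card (PiE ?I ?F)) * (\<Sum>a\<in>?F i. \<Sum>b\<in>?F j. ?h i a j b)" if "i \<in> ?I" "j \<in> ?I" for i j
  proof (cases "i = j")
    case True
    then have "{(i, a), (j, b)} \<notin> E" for a b
      using E(1) multipartite_edge_fst_neq by fastforce
    then show ?thesis by simp
  next
    case False
    then show ?thesis
      using sum_PiE_pair[of ?I ?F i j "\<lambda>a b. ?h i a j b"] that
      by (simp add: sum_distrib_left mult_ac)
  qed
  have "(\<Sum>v\<in>PiE ?I ?F. ?W v) =
      (\<Sum>v\<in>PiE ?I ?F. \<Sum>i\<in>?I. \<Sum>j\<in>?I. real (n i) * (real (n j) * ?h i (v i) j (v j)))"
    by (simp only: weight_def induced_def sum_distrib_left)
  also have "\<dots> = (\<Sum>i\<in>?I. \<Sum>v\<in>PiE ?I ?F. \<Sum>j\<in>?I. real (n i) * (real (n j) * ?h i (v i) j (v j)))"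
    by (rule sum.swap)
  also have "\<dots> = (\<Sum>i\<in>?I. \<Sum>j\<in>?I. \<Sum>v\<in>PiE ?I ?F. real (n i) * (real (n j) * ?h i (v i) j (v j)))"
    by (intro sum.cong refl sum.swap)
  also have "\<dots> = (\<Sum>i\<in>?I. \<Sum>j\<in>?I. real (card (PiE ?I ?F)) * (\<Sum>a\<in>?F i. \<Sum>b\<in>?F j. ?h i a j b))"
    using pair by (intro sum.cong refl) auto
  also have "\<dots> = real (card (PiE ?I ?F)) * (\<Sum>i\<in>?I. \<Sum>j\<in>?I. \<Sum>a\<in>?F i. \<Sum>b\<in>?F j. ?h i a j b)"
    by (simp only: sum_distrib_left)
  also have "(\<Sum>i\<in>?I. \<Sum>j\<in>?I. \<Sum>a\<in>?F i. \<Sum>b\<in>?F j. ?h i a j b)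
      = (\<Sum>u\<in>?V. \<Sum>w\<in>?V. of_bool ({u, w} \<in> E))"
    unfolding sum_multipartite_verts by (intro sum.cong refl sum.swap)
  also have "\<dots> = real (card {(u, w). u \<in> ?V \<and> w \<in> ?V \<and> {u, w} \<in> E})"
    by (rule card_pairs_eq_sum[symmetric]) simp
  also have "{(u, w). u \<in> ?V \<and> w \<in> ?V \<and> {u, w} \<in> E} = {(u, w). {u, w} \<in> E}"
    using EV by auto
  also have "card \<dots> = 2 * card E"
    using E(1) finite_multipartite_edges card_multipartite_edge
    by (intro card_ordered_edges) (auto intro: finite_subset)
  finally have "(\<Sum>v\<in>PiE ?I ?F. 2 * card E - ?W v) = 0"
    by (simp add: sum_subtractf)
  \<comment> \<open>By \<open>le\<close> every deficit is nonnegative, so a zero total forces each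
    one to vanish.\<close>
  then have "\<forall>v\<in>PiE ?I ?F. 2 * card E - ?W v = 0"
    using le by (subst (asm) sum_nonneg_eq_0_iff) (auto intro!: finite_PiE)
  moreover have "restrict v ?I \<in> PiE ?I ?F" using v by (auto simp: transversals_def)
  moreover have "?W (restrict v ?I) = ?W v"
    by (simp add: weight_def induced_def)
  ultimately show ?thesis by fastforce
qed

lemma weighted_extremal_induced:
  assumes "extremal r n t E" "t > 0" "v \<in> transversals r n"
  shows "weighted_extremal t (nonempty_parts r n) (\<lambda>i. real (n i)) (induced E v)"
proof
  have E: "E \<subseteq> multipartite_edges r n" "complete_free t (multipartite_verts r n) E"
    using assms by (auto simp: extremal_def free_spanning_subgraphs_def)
  show "symp (induced E v)" by (auto simp: symp_def induced_sym)
  show "irreflp (induced E v)" using E(1) by (rule irreflp_induced)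
  show "no_clique t (nonempty_parts r n) (induced E v)"
    using E assms by (intro no_clique_induced)
  show "weight (\<lambda>i. real (n i)) (nonempty_parts r n) B
      \<le> weight (\<lambda>i. real (n i)) (nonempty_parts r n) (induced E v)"
    if "symp B" "irreflp B" "no_clique t (nonempty_parts r n) B" for B
    using weight_le_extremal weight_induced_extremal assms that by metis
qed (auto simp: nonempty_parts_def)

section \<open>Gluing the nonadjacency classes of all transversals\<close>

text \<open>In a transversal \<open>v\<close> with clique \<open>R\<close> the nonadjacency classes \<open>C a\<close> are indexed by \<open>a \<in> R\<close>. Some
  part \<open>l a\<close> with index in \<open>C a\<close> is rigid: none of its vertices can join another class. Otherwise
  every member of \<open>C a\<close> could be moved to another class simultaneously, and that transversal would
  have no clique of size \<open>t - 1\<close>.\<close>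

lemma k_partite_if_transversals:
  fixes r t :: nat and n :: "nat \<Rightarrow> nat"
  defines "I \<equiv> nonempty_parts r n"
  assumes E: "E \<subseteq> multipartite_edges r n" and "t \<ge> 2"
    and trans: "\<And>v x y z. v \<in> transversals r n \<Longrightarrow> x \<in> I \<Longrightarrow> y \<in> I \<Longrightarrow> z \<in> I \<Longrightarrow>
      \<not> induced E v x y \<Longrightarrow> \<not> induced E v y z \<Longrightarrow> \<not> induced E v x z"
    and clq: "\<And>v. v \<in> transversals r n \<Longrightarrow> \<exists>S\<subseteq>I. card S = t - 1 \<and> pairwise (induced E v) S"
    and free: "\<And>v. v \<in> transversals r n \<Longrightarrow> no_clique t I (induced E v)"
  shows "k_partite (t - 1) (multipartite_verts r n) E"
proof -
  have finI: "finite I" by (simp add: I_def)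
  have V_iff: "(k, y) \<in> multipartite_verts r n \<longleftrightarrow> k \<in> I \<and> y \<in> {1..n k}" for k y
    by (auto simp: I_def multipartite_verts_eq)
  have T_iff: "u \<in> transversals r n \<longleftrightarrow> (\<forall>i\<in>I. u i \<in> {1..n i})" for u
    by (auto simp: transversals_def I_def)
  have E_neq: "k \<noteq> j" if "{(k, y), (j, z)} \<in> E" for k y j z
    using that E multipartite_edge_fst_neq[of "(k, y)" "(j, z)"] by auto
  have irr: "\<not> induced E u k k" for u k
    using E_neq[of k "u k" k "u k"] by (auto simp: induced_def)
  define v :: "nat \<Rightarrow> nat" where "v = (\<lambda>_. 1)"
  have vT: "v \<in> transversals r n" by (auto simp: T_iff v_def I_def nonempty_parts_def)
  have updT: "u(k := y) \<in> transversals r n" if "u \<in> transversals r n" "y \<in> {1..n k}" for u k y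
    using that by (auto simp: T_iff)
  obtain R where R: "R \<subseteq> I" "card R = t - 1" "pairwise (induced E v) R" using clq[OF vT] by blast
  have finR: "finite R" using R finI finite_subset by blast
  define C where "C a = {k \<in> I. \<not> induced E v k a}" for a
  \<comment> \<open>An index outside all classes would extend the clique \<open>R\<close> to size
    \<open>t\<close>.\<close>
  have C_cover: "\<exists>b\<in>R. k \<in> C b" if k: "k \<in> I" for k
  proof (rule ccontr)
    assume "\<not> ?thesis"
    then have adj: "induced E v k b" if "b \<in> R" for b using that k by (auto simp: C_def)
    then have "k \<notin> R" using irr by blast
    then have "card (insert k R) = t" using R finR \<open>t \<ge> 2\<close> by simp
    moreover have "pairwise (induced E v) (insert k R)"
      using R adj induced_sym by (auto simp: pairwise_insert)
    ultimately show False using free[OF vT] k R by (auto simp: no_clique_def)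
  qed
  have C_self: "a \<in> C a" if "a \<in> R" for a using that R irr by (auto simp: C_def)
  have C_disj: "a = b" if "a \<in> R" "b \<in> R" "k \<in> C a" "k \<in> C b" for a b k
  proof (rule ccontr)
    assume "a \<noteq> b"
    then have "induced E v a b" using R that by (auto simp: pairwise_def)
    moreover have "\<not> induced E v a b"
      using trans[OF vT, of a k b] that R by (auto simp: C_def induced_sym[of _ _ k])
    ultimately show False by blast
  qed
  have "\<exists>l\<in>C a. \<forall>y\<in>{1..n l}. \<forall>b\<in>R - {a}. {(l, y), (b, v b)} \<in> E" if a: "a \<in> R" for a
  proof (rule ccontr)
    assume "\<not> ?thesis"
    then obtain x \<beta> where x: "\<And>l. l \<in> C a \<Longrightarrow> x l \<in> {1..n l}"
      and \<beta>: "\<And>l. l \<in> C a \<Longrightarrow> \<beta> l \<in> R - {a}"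
      and nadj: "\<And>l. l \<in> C a \<Longrightarrow> {(l, x l), (\<beta> l, v (\<beta> l))} \<notin> E"
      by metis
    \<comment> \<open>All members of \<open>C a\<close> move at once, each to a vertex with a
      nonneighbour among those of \<open>R - {a}\<close>; the latter stay in place.\<close>
    define u where "u k = (if k \<in> C a then x k else v k)" for k
    have uT: "u \<in> transversals r n" using vT x by (auto simp: T_iff u_def)
    obtain S where S: "S \<subseteq> I" "card S = t - 1" "pairwise (induced E u) S" using clq[OF uT] by blast
    have u_R: "u b = v b" if "b \<in> R - {a}" for b
      using that C_disj[of a b b] C_self a by (auto simp: u_def)
    \<comment> \<open>Only \<open>t - 2\<close> nonneighbours are available for the
      \<open>t - 1\<close> members of \<open>S\<close>, so two members share one and are nonadjacent
      by transitivity.\<close>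
    have "\<exists>b\<in>R - {a}. \<not> induced E u s b" if s: "s \<in> S" for s
    proof (cases "s \<in> C a")
      case True
      then have "\<not> induced E u s (\<beta> s)"
        using nadj[OF True] u_R[OF \<beta>[OF True]] by (simp add: induced_def u_def)
      then show ?thesis using \<beta>[OF True] by blast
    next
      case False
      obtain b where b: "b \<in> R" "s \<in> C b" using C_cover s S by blast
      then have "b \<in> R - {a}" using False by auto
      moreover have "\<not> induced E u s b"
        using b u_R[OF \<open>b \<in> R - {a}\<close>] False by (simp add: C_def induced_def u_def)
      ultimately show ?thesis by blast
    qed
    then obtain \<gamma> where \<gamma>: "\<And>s. s \<in> S \<Longrightarrow> \<gamma> s \<in> R - {a}" "\<And>s. s \<in> S \<Longrightarrow> \<not> induced E u s (\<gamma> s)"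
      by metis
    have "card (\<gamma> ` S) \<le> card (R - {a})" using \<gamma>(1) finR by (intro card_mono) auto
    also have "\<dots> < card S" using a finR R S \<open>t \<ge> 2\<close> by simp
    finally have "\<not> inj_on \<gamma> S" by (rule pigeonhole)
    then obtain s s' where s: "s \<in> S" "s' \<in> S" "s \<noteq> s'" "\<gamma> s = \<gamma> s'" by (auto simp: inj_on_def)
    have "\<not> induced E u s s'"
      using trans[OF uT, of s "\<gamma> s" s'] \<gamma>[OF s(1)] \<gamma>[OF s(2)] s S R
      by (auto simp: induced_sym[of _ _ "\<gamma> s'"])
    then show False using S s by (auto simp: pairwise_def)
  qed
  then obtain l where l: "\<And>a. a \<in> R \<Longrightarrow> l a \<in> C a"
    and rigid: "\<And>a y b. a \<in> R \<Longrightarrow> y \<in> {1..n (l a)} \<Longrightarrow> b \<in> R - {a} \<Longrightarrow> {(l a, y), (b, v b)} \<in> E"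
    by metis
  have lI: "l a \<in> I" if "a \<in> R" for a using l[OF that] by (simp add: C_def)
  have l_inj: "inj_on l R" using l C_disj by (metis inj_onI)
  \<comment> \<open>\<open>l a\<close> may differ from \<open>a\<close>, so the vertices
    \<open>q a\<close> take over as class representatives.\<close>
  define q where "q a = (l a, v (l a))" for a
  \<comment> \<open>Changing the vertex in part \<open>l a\<close> leaves \<open>l b\<close> and
    \<open>b\<close> nonadjacent, so adjacency of \<open>l a\<close> to \<open>b\<close> passes to
    \<open>l b\<close> by transitivity.\<close>
  have rigid_q: "{(l a, y), q b} \<in> E" if ab: "a \<in> R" "b \<in> R" "a \<noteq> b" and y: "y \<in> {1..n (l a)}" for a b y
  proof -
    let ?u = "v(l a := y)"
    have uT: "?u \<in> transversals r n" using updT vT y by blast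
    have ne: "l b \<noteq> l a" "b \<noteq> l a"
      using l_inj ab l C_self C_disj by (metis inj_onD) (use ab l C_self C_disj in metis)
    have "\<not> induced E ?u (l b) b" using l[OF ab(2)] ne by (simp add: induced_def C_def)
    moreover have "induced E ?u (l a) b" using rigid[of a y b] ab y ne by (simp add: induced_def)
    ultimately have "induced E ?u (l a) (l b)"
      using trans[OF uT, of "l a" "l b" b] lI ab R by blast
    then show ?thesis using ne by (simp add: induced_def q_def)
  qed
  \<comment> \<open>These are the final classes. Comparing with the fixed vertex \<open>q a\<close>
    makes membership independent of the transversal.\<close>
  define P where "P a = {p \<in> multipartite_verts r n. {p, q a} \<notin> E}" for a
  \<comment> \<open>A vertex adjacent to every \<open>q a\<close> would form a clique of size
    \<open>t\<close> with them.\<close>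
  have P_cover: "\<exists>a\<in>R. p \<in> P a" if p: "p \<in> multipartite_verts r n" for p
  proof (rule ccontr)
    assume "\<not> ?thesis"
    then have adj: "{p, q a} \<in> E" if "a \<in> R" for a using p that by (auto simp: P_def)
    obtain k y where ky: "p = (k, y)" by fastforce
    let ?u = "v(k := y)"
    have kl: "k \<noteq> l a" if "a \<in> R" for a
      using E_neq[of k y "l a" "v (l a)"] adj[OF that] by (simp add: ky q_def)
    have uT: "?u \<in> transversals r n" using updT vT p by (simp add: ky V_iff)
    have "pairwise (induced E ?u) (insert k (l ` R))"
      unfolding pairwise_insert
    proof (intro conjI allI impI)
      show "pairwise (induced E ?u) (l ` R)"
      proof (intro pairwiseI)
        fix i i' assume "i \<in> l ` R" "i' \<in> l ` R" "i \<noteq> i'"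
        then obtain b c where bc: "b \<in> R" "c \<in> R" "b \<noteq> c" "i = l b" "i' = l c" by auto
        have "v (l b) \<in> {1..n (l b)}" using vT lI bc by (auto simp: T_iff)
        from rigid_q[OF bc(1-3) this] show "induced E ?u i i'"
          using kl[OF bc(1)] kl[OF bc(2)] by (simp add: induced_def q_def bc)
      qed
    next
      fix j assume "j \<in> l ` R \<and> j \<noteq> k"
      then obtain b where b: "b \<in> R" "j = l b" by auto
      show "induced E ?u k j"
        using adj[OF b(1)] kl[OF b(1)] by (simp add: induced_def q_def ky b)
      then show "induced E ?u j k" using induced_sym by blast
    qed
    moreover have "card (insert k (l ` R)) = t"
      using kl finR R l_inj \<open>t \<ge> 2\<close> by (subst card_insert_disjoint) (auto simp: card_image)
    moreover have "insert k (l ` R) \<subseteq> I" using lI p ky V_iff by auto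
    ultimately show False using free[OF uT] by (auto simp: no_clique_def)
  qed
  have P_disj: "a = b" if ab: "a \<in> R" "b \<in> R" and p: "p \<in> P a" "p \<in> P b" for a b p
  proof (rule ccontr)
    assume "a \<noteq> b"
    obtain k y where ky: "p = (k, y)" by fastforce
    have k: "k \<in> I" "y \<in> {1..n k}" using p by (auto simp: P_def ky V_iff)
    let ?u = "v(k := y)"
    \<comment> \<open>In part \<open>l a\<close> or \<open>l b\<close>, rigidity would make
      \<open>p\<close> adjacent to \<open>q b\<close> or \<open>q a\<close>. So \<open>p\<close>,
      \<open>q a\<close>, \<open>q b\<close> share a transversal, where transitivity
      applies.\<close>
    have ne: "k \<noteq> l a" "k \<noteq> l b"
      using rigid_q[of a b y] rigid_q[of b a y] \<open>a \<noteq> b\<close> ab k p by (auto simp: P_def ky)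
    have uT: "?u \<in> transversals r n" using updT vT k by simp
    have "\<not> induced E ?u (l a) k" "\<not> induced E ?u k (l b)"
      using p ne by (auto simp: P_def ky q_def induced_def insert_commute)
    then have "\<not> induced E ?u (l a) (l b)" using trans[OF uT] lI ab k by blast
    moreover have "{(l a, v (l a)), q b} \<in> E"
      using ab \<open>a \<noteq> b\<close> lI vT by (intro rigid_q) (auto simp: T_iff)
    ultimately show False using ne by (auto simp: induced_def q_def)
  qed
  \<comment> \<open>No transversal contains both \<open>q a\<close> and another vertex of part
    \<open>l a\<close>, so transitivity through \<open>q a\<close> cannot handle this part. Instead,
    an edge would complete a clique of size \<open>t\<close> with the vertices \<open>q b\<close>,
    \<open>b \<noteq> a\<close>.\<close>
  have rigid_P: "{(l a, y), p} \<notin> E" if a: "a \<in> R" and y: "y \<in> {1..n (l a)}" and p: "p \<in> P a" for a y p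
  proof
    assume edge: "{(l a, y), p} \<in> E"
    obtain j z where jz: "p = (j, z)" by fastforce
    have j: "j \<in> I" "z \<in> {1..n j}" using p by (auto simp: P_def jz V_iff)
    have adj: "{p, q b} \<in> E" if "b \<in> R" "b \<noteq> a" for b
      using P_disj[of a b p] that a p by (auto simp: P_def)
    \<comment> \<open>\<open>p\<close> has a neighbour in each part \<open>l b\<close>: the vertex
      \<open>y\<close> if \<open>b = a\<close>, and \<open>q b\<close> otherwise.\<close>
    have jl: "j \<noteq> l b" if "b \<in> R" for b
      using E_neq[of j z "l b" "v (l b)"] E_neq[OF edge[unfolded jz]] adj[OF that]
      unfolding jz q_def by (cases "b = a") auto
    let ?u = "v(l a := y, j := z)"
    have uT: "?u \<in> transversals r n" using updT vT y j by simp
    have ul: "?u (l b) = (if b = a then y else v (l b))" if "b \<in> R" for b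
      using jl[OF that] inj_onD[OF l_inj _ that a] by auto
    have "pairwise (induced E ?u) (insert j (l ` R))"
      unfolding pairwise_insert
    proof (intro conjI allI impI)
      show "pairwise (induced E ?u) (l ` R)"
      proof (intro pairwiseI)
        fix i i' assume "i \<in> l ` R" "i' \<in> l ` R" "i \<noteq> i'"
        then obtain b c where bc: "b \<in> R" "c \<in> R" "b \<noteq> c" "i = l b" "i' = l c" by auto
        have vb: "v (l b) \<in> {1..n (l b)}" "v (l c) \<in> {1..n (l c)}" using vT lI bc by (auto simp: T_iff)
        show "induced E ?u i i'"
        \<comment> \<open>\<open>rigid_q\<close> lets only its first vertex vary, so part
          \<open>l a\<close> must take that role.\<close>
        proof (cases "c = a")
          case True
          then show ?thesis
            using rigid_q[of a b y] bc y unfolding induced_def bc(4,5) ul[OF bc(1)] ul[OF bc(2)] q_def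
            by (simp add: insert_commute)
        next
          case False
          then show ?thesis
            using rigid_q[of b c "?u (l b)"] bc y vb unfolding induced_def bc(4,5) ul[OF bc(1)] ul[OF bc(2)] q_def
            by auto
        qed
      qed
    next
      fix i assume "i \<in> l ` R \<and> i \<noteq> j"
      then obtain b where b: "b \<in> R" "i = l b" by auto
      show "induced E ?u j i"
        using edge adj[OF b(1)] unfolding induced_def b(2) ul[OF b(1)] jz q_def
        by (auto simp: insert_commute)
      then show "induced E ?u i j" using induced_sym by blast
    qed
    moreover have "card (insert j (l ` R)) = t"
      using jl finR R l_inj \<open>t \<ge> 2\<close> by (subst card_insert_disjoint) (auto simp: card_image)
    moreover have "insert j (l ` R) \<subseteq> I" using lI j by auto
    ultimately show False using free[OF uT] by (auto simp: no_clique_def)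
  qed
  have P_indep: "indep (P a) E" if a: "a \<in> R" for a
    unfolding indep_def
  proof (intro ballI impI notI)
    fix p p' assume p: "p \<in> P a" "p' \<in> P a" and edge: "{p, p'} \<in> E"
    obtain k y j z where kj: "p = (k, y)" "p' = (j, z)" by fastforce
    have k: "k \<in> I" "y \<in> {1..n k}" "j \<in> I" "z \<in> {1..n j}"
      using p by (auto simp: P_def kj V_iff)
    have "k \<noteq> l a" using rigid_P[OF a, of y p'] edge k p kj by auto
    moreover have "j \<noteq> l a" using rigid_P[OF a, of z p] edge k p kj by (auto simp: insert_commute)
    moreover have "k \<noteq> j" using E_neq edge kj by blast
    moreover have "v(k := y, j := z) \<in> transversals r n" using updT vT k by simp
    \<comment> \<open>The vertices \<open>p\<close>, \<open>q a\<close>, \<open>p'\<close> lie in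
      three distinct parts, so one transversal contains them all and transitivity through
      \<open>l a\<close> contradicts the edge.\<close>
    ultimately show False
      using trans[of "v(k := y, j := z)" k "l a" j] k lI[OF a] p edge
      by (auto simp: induced_def P_def kj q_def insert_commute)
  qed
  obtain g where g: "bij_betw g {1..t - 1} R"
    using finR R(2) finite_same_card_bij[of "{1..t - 1}" R] by auto
  have gR: "g i \<in> R" if "i \<in> {1..t - 1}" for i using g that bij_betwE by blast
  show ?thesis
    unfolding k_partite_def
  proof (intro exI[of _ "P \<circ> g"] conjI ballI)
    show "disjoint_family_on (P \<circ> g) {1..t - 1}"
      unfolding disjoint_family_on_def
    proof (intro ballI impI)
      fix i j assume ij: "i \<in> {1..t - 1}" "j \<in> {1..t - 1}" "i \<noteq> j"
      then have "g i \<noteq> g j" using bij_betw_imp_inj_on[OF g] by (auto dest: inj_onD)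
      then show "(P \<circ> g) i \<inter> (P \<circ> g) j = {}" using P_disj[OF gR[OF ij(1)] gR[OF ij(2)]] by auto
    qed
    have "(\<Union>i\<in>{1..t - 1}. (P \<circ> g) i) = (\<Union>a\<in>R. P a)"
      unfolding bij_betw_imp_surj_on[OF g, symmetric] by simp
    also have "\<dots> = multipartite_verts r n" using P_cover by (auto simp: P_def)
    finally show "(\<Union>i\<in>{1..t - 1}. (P \<circ> g) i) = multipartite_verts r n" .
  qed (use P_indep gR in auto)
qed

theorem theorem1p7:
  fixes r t :: nat
  assumes "t \<ge> 3" and "r \<ge> t"
  shows "\<exists>N::nat. \<forall>n :: nat \<Rightarrow> nat.
           (\<forall>i j. 1 \<le> i \<longrightarrow> i \<le> j \<longrightarrow> j \<le> r \<longrightarrow> n j \<le> n i) \<longrightarrow> N \<le> n (t - 1) \<longrightarrow>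
           (\<forall>E. extremal r n t E \<longrightarrow> k_partite (t - 1) (multipartite_verts r n) E)"
proof (intro exI[of _ 1] allI impI)
  fix n :: "nat \<Rightarrow> nat" and E
  assume mono: "\<forall>i j. 1 \<le> i \<longrightarrow> i \<le> j \<longrightarrow> j \<le> r \<longrightarrow> n j \<le> n i"
    and "1 \<le> n (t - 1)" and ext: "extremal r n t E"
  have "n (t - 1) \<le> n i" if "i \<in> {1..t - 1}" for i using that mono assms by auto
  \<comment> \<open>By monotonicity the bound on \<open>n (t - 1)\<close> makes the first
    \<open>t - 1\<close> parts nonempty, which supplies the vertices that \<open>ex_clique\<close>
    needs.\<close>
  then have "{1..t - 1} \<subseteq> nonempty_parts r n"
    using \<open>1 \<le> n (t - 1)\<close> assms by (fastforce simp: nonempty_parts_def)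
  then have card: "t - 1 \<le> card (nonempty_parts r n)"
    using card_mono[of "nonempty_parts r n" "{1..t - 1}"] by simp
  have weighted: "weighted_extremal t (nonempty_parts r n) (\<lambda>i. real (n i)) (induced E v)"
    if "v \<in> transversals r n" for v
    using weighted_extremal_induced[OF ext _ that] assms by simp
  show "k_partite (t - 1) (multipartite_verts r n) E"
  proof (rule k_partite_if_transversals)
    show "E \<subseteq> multipartite_edges r n" using ext by (auto simp: extremal_def free_spanning_subgraphs_def)
    show "\<exists>S\<subseteq>nonempty_parts r n. card S = t - 1 \<and> pairwise (induced E v) S"
      if "v \<in> transversals r n" for v
      using weighted_extremal.ex_clique[OF weighted[OF that]] card assms by (metis le_trans one_le_numeral)
    show "no_clique t (nonempty_parts r n) (induced E v)" if "v \<in> transversals r n" for v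
      using weighted_extremal.free[OF weighted[OF that]] .
    show "2 \<le> t" using assms by simp
  qed (rule weighted_extremal.nonadjacent_trans[OF weighted])
qed

end
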